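(* Let $M=M(\lambda)\in\mathbb{W}^{n\times n}$, let $\{1,\dots,n\}=S\cup\overline S$ be a partition with $S\ne\varnothing$, and let $\lambda_0\in\mathbb{C}$ be such that $M_{\overline S\,\overline S}(\lambda_0)-\lambda_0I$ is invertible. If either (i) $M_{S\overline S}(\lambda_0)=0$, or (ii) $M_{\overline SS}(\lambda_0)=0$, then the generalized eigenvectors of $M$ for $\lambda_0$ are preserved under the isospectral reduction of $M$ onto $S$.
   Context: $\mathbb{W}$ is the field of rational functions in $\lambda$ over $\mathbb{C}$. Writing $M(\lambda_0)$ presupposes that the entries have no pole at $\lambda_0$. For index sets $A,B$, $M_{AB}$ is the submatrix with rows in $A$ and columns in $B$; $u_S,u_{\overline S}$ denote restrictions of a vector $u$. The isospectral reduction of $M$ onto $S$ is $R_S(\lambda)=M_{SS}-M_{S\overline S}(M_{\overline S\,\overline S}-\lambda I)^{-1}M_{\overline SS}$. Let $u\in\mathbb{C}^n$, $u\ne0$, be an eigenvector of $M(\lambda_0)$ for $\lambda_0$ (rank 1) or a generalized eigenvector of rank $k\geq2$ (that is, $(M(\lambda_0)-\lambda_0I)^ku=0$ and $(M(\lambda_0)-\lambda_0I)^{k-1}u\neq0$), and let $v\in\mathbb{C}^n$ satisfy $(M(\lambda_0)-\lambda_0I)v=u$, so that $v$ is a generalized eigenvector of the next rank. The generalized eigenvector $v$ is said to be preserved if there is $c\in\mathbb{C}$, $c\neq1$, with $$M_{S\overline S}(\lambda_0)(M_{\overline S\,\overline S}(\lambda_0)-\lambda_0I)^{-1}u_{\overline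 S}=c\,u_S$$ (equivalently $(R_S(\lambda_0)-\lambda_0I)v_S=(1-c)u_S$). "The generalized eigenvectors are preserved" means that this holds for all such pairs $(u,v)$. *)

theory Defs
  imports
    "HOL-Computational_Algebra.Fraction_Field"
    "Jordan_Normal_Form.Char_Poly"
    "Jordan_Normal_Form.Gauss_Jordan_Elimination"
    "Jordan_Normal_Form.DL_Submatrix"
begin

section \<open>Rational functions and their values\<close>

type_synonym ratfun = "complex poly fract"

text \<open>The indeterminate of the field of rational functions.\<close>

definition ratfun_var :: ratfun where
  "ratfun_var = Fract [:0, 1:] 1"

definition has_value :: "ratfun \<Rightarrow> complex \<Rightarrow> complex \<Rightarrow> bool" where
  "has_value f z w \<longleftrightarrow> (\<exists>p q. f = Fract p q \<and> poly q z \<noteq> 0 \<and> w = poly p z / poly q z)"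

definition no_pole :: "ratfun \<Rightarrow> complex \<Rightarrow> bool" where
  "no_pole f z \<longleftrightarrow> (\<exists>p q. f = Fract p q \<and> poly q z \<noteq> 0)"

text \<open>Only meaningful if \<open>f\<close> has no pole at \<open>z\<close>.\<close>

definition ratfun_at :: "ratfun \<Rightarrow> complex \<Rightarrow> complex" where
  "ratfun_at f z = (THE w. has_value f z w)"

definition no_pole_mat :: "ratfun mat \<Rightarrow> complex \<Rightarrow> bool" where
  "no_pole_mat M z \<longleftrightarrow> (\<forall>i<dim_row M. \<forall>j<dim_col M. no_pole (M $$ (i, j)) z)"

definition mat_at :: "ratfun mat \<Rightarrow> complex \<Rightarrow> complex mat" where
  "mat_at M z = map_mat (\<lambda>f. ratfun_at f z) M"

lemma has_value_unique:
  assumes "has_value f z w" "has_value f z w'"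
  shows "w = w'"
proof -
  from assms obtain p q p' q' where
    *: "f = Fract p q" "poly q z \<noteq> 0" "w = poly p z / poly q z"
       "f = Fract p' q'" "poly q' z \<noteq> 0" "w' = poly p' z / poly q' z"
    unfolding has_value_def by blast
  hence "q \<noteq> 0" "q' \<noteq> 0" by auto
  with * have "p * q' = p' * q" by (metis eq_fract(1))
  hence "poly p z * poly q' z = poly p' z * poly q z" by (metis poly_mult)
  with *(2,5) show ?thesis unfolding *(3,6) by (simp add: frac_eq_eq)
qed

lemma ratfun_at_eqI: "has_value f z w \<Longrightarrow> ratfun_at f z = w"
  unfolding ratfun_at_def using has_value_unique by blast

lemma ratfun_at_Fract: "poly q z \<noteq> 0 \<Longrightarrow> ratfun_at (Fract p q) z = poly p z / poly q z"
  by (rule ratfun_at_eqI) (auto simp: has_value_def)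

lemma no_pole_has_value: "no_pole f z \<Longrightarrow> has_value f z (ratfun_at f z)"
  unfolding no_pole_def using ratfun_at_Fract has_value_def by blast

section \<open>Isospectral reductions and preserved generalized eigenvectors\<close>

text \<open>
  Vectors and matrices are indexed by \<open>{0..<n}\<close>. The restriction of a vector to an index set,
  enumerated increasingly, in accordance with \<^const>\<open>submatrix\<close>.
\<close>

definition subvector :: "'a vec \<Rightarrow> nat set \<Rightarrow> 'a vec" where
  "subvector u S = vec (card {i. i < dim_vec u \<and> i \<in> S}) (\<lambda>i. u $ pick S i)"

text \<open>The set \<open>T\<close> plays the role of the complement of \<open>S\<close>.\<close>

definition isospectral_reduction :: "ratfun mat \<Rightarrow> nat set \<Rightarrow> nat set \<Rightarrow> ratfun mat" where
  "isospectral_reduction M S T =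
     submatrix M S S
     - submatrix M S T * the (mat_inverse (submatrix M T T - ratfun_var \<cdot>\<^sub>m 1\<^sub>m (card T)))
       * submatrix M T S"

definition gen_eigenvector :: "complex mat \<Rightarrow> complex \<Rightarrow> nat \<Rightarrow> complex vec \<Rightarrow> bool" where
  "gen_eigenvector A z k u \<longleftrightarrow>
     (k = 1 \<and> eigenvector A u z) \<or>
     (k \<ge> 2 \<and> u \<in> carrier_vec (dim_row A) \<and>
      (A - z \<cdot>\<^sub>m 1\<^sub>m (dim_row A)) ^\<^sub>m k *\<^sub>v u = 0\<^sub>v (dim_row A) \<and>
      (A - z \<cdot>\<^sub>m 1\<^sub>m (dim_row A)) ^\<^sub>m (k - 1) *\<^sub>v u \<noteq> 0\<^sub>v (dim_row A))"

text \<open>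
  Whether a solution \<open>v\<close> of \<open>(M(z) - z I) v = u\<close> is preserved depends only on \<open>u\<close>;
  the lemma \<open>preserved_iff_isospectral_reduction\<close> below is the formulation in terms of \<open>v\<close> and
  the isospectral reduction.
\<close>

definition preserved :: "ratfun mat \<Rightarrow> nat set \<Rightarrow> nat set \<Rightarrow> complex \<Rightarrow> complex vec \<Rightarrow> bool" where
  "preserved M S T z u \<longleftrightarrow>
     (\<exists>c. c \<noteq> 1 \<and>
        submatrix (mat_at M z) S T
          *\<^sub>v (the (mat_inverse (submatrix (mat_at M z) T T - z \<cdot>\<^sub>m 1\<^sub>m (card T)))
          *\<^sub>v subvector u T)
        = c \<cdot>\<^sub>v subvector u S)"

definition gen_eigenvectors_preserved ::
  "ratfun mat \<Rightarrow> nat set \<Rightarrow> nat set \<Rightarrow> complex \<Rightarrow> bool" where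
  "gen_eigenvectors_preserved M S T z \<longleftrightarrow>
     (\<forall>k u v. gen_eigenvector (mat_at M z) z k u \<longrightarrow>
        v \<in> carrier_vec (dim_row M) \<longrightarrow>
        (mat_at M z - z \<cdot>\<^sub>m 1\<^sub>m (dim_row M)) *\<^sub>v v = u \<longrightarrow>
        preserved M S T z u)"

section \<open>Preservation in terms of the isospectral reduction\<close>

lemma has_value_const: "has_value (Fract [:a:] 1) z a"
  unfolding has_value_def by (intro exI[of _ "[:a:]"] exI[of _ 1]) auto

lemma has_value_0: "has_value 0 z 0" and has_value_1: "has_value 1 z 1"
  using has_value_const[of 0 z] has_value_const[of 1 z]
  by (simp_all add: Zero_fract_def One_fract_def one_pCons)

lemma has_value_var: "has_value ratfun_var z z"
  unfolding has_value_def ratfun_var_def by (intro exI[of _ "[:0,1:]"] exI[of _ 1]) auto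

lemma has_value_add:
  assumes "has_value f z a" "has_value g z b"
  shows "has_value (f + g) z (a + b)"
proof -
  from assms obtain p q p' q' where
    *: "f = Fract p q" "poly q z \<noteq> 0" "a = poly p z / poly q z"
       "g = Fract p' q'" "poly q' z \<noteq> 0" "b = poly p' z / poly q' z"
    unfolding has_value_def by blast
  hence "q \<noteq> 0" "q' \<noteq> 0" by auto
  with * show ?thesis unfolding has_value_def
    by (intro exI[of _ "p * q' + p' * q"] exI[of _ "q * q'"]) (simp add: add_frac_eq)
qed

lemma has_value_mult:
  assumes "has_value f z a" "has_value g z b"
  shows "has_value (f * g) z (a * b)"
proof -
  from assms obtain p q p' q' where
    *: "f = Fract p q" "poly q z \<noteq> 0" "a = poly p z / poly q z"
       "g = Fract p' q'" "poly q' z \<noteq> 0" "b = poly p' z / poly q' z"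
    unfolding has_value_def by blast
  thus ?thesis unfolding has_value_def
    by (intro exI[of _ "p * p'"] exI[of _ "q * q'"]) auto
qed

lemma has_value_uminus: "has_value f z a \<Longrightarrow> has_value (- f) z (- a)"
  unfolding has_value_def by (metis divide_minus_left minus_fract poly_minus)

lemma has_value_diff:
  "has_value f z a \<Longrightarrow> has_value g z b \<Longrightarrow> has_value (f - g) z (a - b)"
  using has_value_add[OF _ has_value_uminus] by fastforce

lemma has_value_inverse:
  assumes "has_value f z a" "a \<noteq> 0"
  shows "has_value (inverse f) z (inverse a)"
proof -
  from assms obtain p q where
    "f = Fract p q" "poly q z \<noteq> 0" "a = poly p z / poly q z"
    unfolding has_value_def by blast
  with assms show ?thesis unfolding has_value_def
    by (intro exI[of _ q] exI[of _ p]) auto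
qed

lemma has_value_sum:
  "(\<And>i. i \<in> I \<Longrightarrow> has_value (f i) z (a i)) \<Longrightarrow> has_value (sum f I) z (sum a I)"
  by (induction I rule: infinite_finite_induct) (auto intro: has_value_add has_value_0)

lemma has_value_prod:
  "(\<And>i. i \<in> I \<Longrightarrow> has_value (f i) z (a i)) \<Longrightarrow> has_value (prod f I) z (prod a I)"
  by (induction I rule: infinite_finite_induct) (auto intro: has_value_mult has_value_1)

lemma has_value_signof: "has_value (signof p) z (signof p)"
  using has_value_1 has_value_uminus[OF has_value_1] by (auto simp: sign_def)

definition mat_has_value :: "ratfun mat \<Rightarrow> complex \<Rightarrow> complex mat \<Rightarrow> bool" where
  "mat_has_value M z A \<longleftrightarrow> dim_row A = dim_row M \<and> dim_col A = dim_col M \<and>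
     (\<forall>i<dim_row M. \<forall>j<dim_col M. has_value (M $$ (i, j)) z (A $$ (i, j)))"

lemma mat_has_value_imp_mat_at: "mat_has_value M z A \<Longrightarrow> mat_at M z = A"
  unfolding mat_has_value_def mat_at_def by (intro eq_matI) (auto intro: ratfun_at_eqI)

lemma mat_has_value_mat_at: "no_pole_mat M z \<Longrightarrow> mat_has_value M z (mat_at M z)"
  unfolding mat_has_value_def no_pole_mat_def mat_at_def by (auto intro: no_pole_has_value)

lemma mat_has_value_submatrix:
  assumes "mat_has_value M z A"
  shows "mat_has_value (submatrix M I J) z (submatrix A I J)"
  using assms pick_le unfolding mat_has_value_def submatrix_def by auto

lemma mat_has_value_mult:
  assumes "mat_has_value M z A" "mat_has_value N z B" "dim_col M = dim_row N"
  shows "mat_has_value (M * N) z (A * B)"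
  using assms unfolding mat_has_value_def
  by (auto simp: scalar_prod_def intro!: has_value_sum has_value_mult)

lemma mat_has_value_diff:
  assumes "mat_has_value M z A" "mat_has_value N z B" "dim_row M = dim_row N" "dim_col M = dim_col N"
  shows "mat_has_value (M - N) z (A - B)"
  using assms unfolding mat_has_value_def by (auto intro!: has_value_diff)

lemma mat_has_value_var: "mat_has_value (ratfun_var \<cdot>\<^sub>m 1\<^sub>m m) z (z \<cdot>\<^sub>m 1\<^sub>m m)"
  unfolding mat_has_value_def
  using has_value_var has_value_0 by auto

lemma mat_has_value_det:
  assumes "mat_has_value M z A"
  shows "has_value (det M) z (det A)"
  using assms unfolding mat_has_value_def det_def
  by (auto intro!: has_value_sum has_value_mult has_value_prod has_value_signof has_value_0
      simp: permutes_in_image[of _ "{0..<dim_row M}", simplified])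

lemma mat_has_value_cofactor:
  assumes "mat_has_value M z A" "i < dim_row M" "j < dim_col M"
  shows "has_value (cofactor M i j) z (cofactor A i j)"
proof -
  have "mat_has_value (mat_delete M i j) z (mat_delete A i j)"
    using assms unfolding mat_has_value_def mat_delete_def by auto
  moreover have "has_value ((- 1) ^ k) z ((- 1) ^ k)" for k
    by (induction k) (auto intro: has_value_1 has_value_uminus)
  ultimately show ?thesis
    unfolding cofactor_def by (intro has_value_mult mat_has_value_det)
qed

lemma mat_inverse_eqI:
  fixes A :: "'a :: field mat"
  assumes "A \<in> carrier_mat m m" "B \<in> carrier_mat m m" "A * B = 1\<^sub>m m" "B * A = 1\<^sub>m m"
  shows "mat_inverse A = Some B"
proof (cases "mat_inverse A")
  case None
  from mat_inverse(1)[OF assms(1) None, of "()"] assms show ?thesis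
    unfolding Units_def ring_mat_def by auto
next
  case (Some C)
  from mat_inverse(2)[OF assms(1) Some] have C: "A * C = 1\<^sub>m m" "C \<in> carrier_mat m m" by auto
  have "B = B * (A * C)" unfolding C(1) using assms by simp
  also have "\<dots> = (B * A) * C"
    using assoc_mult_mat[OF assms(2,1) C(2)] by simp
  also have "\<dots> = C" unfolding assms(4) using C by simp
  finally have "B = C" .
  with Some show ?thesis by simp
qed

lemma invertible_mat_mat_inverse:
  fixes A :: "'a :: field mat"
  assumes "A \<in> carrier_mat m m" "invertible_mat A"
  obtains B where "mat_inverse A = Some B" "B \<in> carrier_mat m m" "A * B = 1\<^sub>m m" "B * A = 1\<^sub>m m"
proof -
  from assms obtain B where B: "A * B = 1\<^sub>m m" "B * A = 1\<^sub>m (dim_row B)"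
    unfolding invertible_mat_def inverts_mat_def by auto
  have "dim_col (A * B) = m" unfolding B by simp
  moreover have "dim_col (B * A) = dim_row B" unfolding B by simp
  ultimately have "B \<in> carrier_mat m m" using assms by auto
  with B assms mat_inverse_eqI[of A m B] that show thesis by auto
qed

lemma mat_has_value_inverse:
  assumes val: "mat_has_value M z A" and M: "M \<in> carrier_mat m m" and inv: "invertible_mat A"
  shows "mat_has_value (the (mat_inverse M)) z (the (mat_inverse A))"
    and "the (mat_inverse M) \<in> carrier_mat m m"
proof -
  have A: "A \<in> carrier_mat m m" using val M by (auto simp: mat_has_value_def)
  from invertible_mat_mat_inverse[OF A inv] obtain B where
    B: "mat_inverse A = Some B" "B \<in> carrier_mat m m" "A * B = 1\<^sub>m m" by blast
  from det_mult[OF A B(2)] B(3) have dA: "det A \<noteq> 0" by auto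
  note dval = mat_has_value_det[OF val]
  have dM: "det M \<noteq> 0" using has_value_unique[OF dval] has_value_0 dA by metis
  define N where "N = inverse (det M) \<cdot>\<^sub>m adj_mat M"
  note adjM = adj_mat[OF M]
  have N: "N \<in> carrier_mat m m" using adjM unfolding N_def by simp
  have MN: "M * N = 1\<^sub>m m" "N * M = 1\<^sub>m m"
    unfolding N_def using M adjM dM
    by (auto simp: mult_smult_distrib[of M m m _ m] mult_smult_assoc_mat[of _ m m M m])
  have iM: "mat_inverse M = Some N" by (rule mat_inverse_eqI[OF M N MN])
  define C where "C = inverse (det A) \<cdot>\<^sub>m adj_mat A"
  note adjA = adj_mat[OF A]
  have C: "C \<in> carrier_mat m m" using adjA unfolding C_def by simp
  have AC: "A * C = 1\<^sub>m m" "C * A = 1\<^sub>m m"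
    unfolding C_def using A adjA dA
    by (auto simp: mult_smult_distrib[of A m m _ m] mult_smult_assoc_mat[of _ m m A m])
  have iA: "mat_inverse A = Some C" by (rule mat_inverse_eqI[OF A C AC])
  have "mat_has_value N z C"
    using M A val mat_has_value_cofactor[OF val] has_value_inverse[OF dval dA]
    unfolding mat_has_value_def N_def C_def adj_mat_def
    by (auto intro!: has_value_mult)
  with iM iA N show "mat_has_value (the (mat_inverse M)) z (the (mat_inverse A))"
    "the (mat_inverse M) \<in> carrier_mat m m" by simp_all
qed

lemma sum_pick:
  assumes "finite S"
  shows "(\<Sum>i = 0..<card S. f (pick S i)) = sum f S"
proof -
  have inj: "inj_on (pick S) {0..<card S}"
    by (intro inj_onI) (metis atLeastLessThan_iff nat_neq_iff pick_mono_le)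
  have "pick S ` {0..<card S} \<subseteq> S" by (auto intro: pick_in_set_le)
  moreover have "card (pick S ` {0..<card S}) = card S" using inj by (simp add: card_image)
  ultimately have "pick S ` {0..<card S} = S" using assms by (metis card_subset_eq)
  with inj show ?thesis by (metis (no_types, lifting) sum.reindex_cong)
qed

context
  fixes n :: nat and S T :: "nat set"
  assumes part: "S \<union> T = {0..<n}" "S \<inter> T = {}"
begin

lemma part_simps:
  "{i. i < n \<and> i \<in> S} = S" "{i. i < n \<and> i \<in> T} = T" "finite S" "finite T"
proof -
  show "{i. i < n \<and> i \<in> S} = S" "{i. i < n \<and> i \<in> T} = T" using part by auto
  have "finite (S \<union> T)" unfolding part by simp
  thus "finite S" "finite T" by auto
qed

lemma subvector_mult_mat:
  fixes A :: "'a :: comm_ring_1 mat"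
  assumes A: "A \<in> carrier_mat n n" and v: "v \<in> carrier_vec n" and Q: "Q \<in> {S, T}"
  shows "subvector (A *\<^sub>v v) Q
           = submatrix A Q S *\<^sub>v subvector v S + submatrix A Q T *\<^sub>v subvector v T"
proof (rule eq_vecI)
  have cQ: "{i. i < n \<and> i \<in> Q} = Q" using Q part_simps by auto
  show "dim_vec (subvector (A *\<^sub>v v) Q)
          = dim_vec (submatrix A Q S *\<^sub>v subvector v S + submatrix A Q T *\<^sub>v subvector v T)"
    using A v cQ by (simp add: subvector_def submatrix_def)
  fix i
  assume "i < dim_vec (submatrix A Q S *\<^sub>v subvector v S + submatrix A Q T *\<^sub>v subvector v T)"
  hence i: "i < card Q" using A cQ by (simp add: submatrix_def)
  from pick_in_set_le[OF this] cQ have p: "pick Q i < n" by auto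
  let ?f = "\<lambda>j. A $$ (pick Q i, j) * v $ j"
  have "subvector (A *\<^sub>v v) Q $ i = sum ?f {0..<n}"
    using A v i p cQ by (simp add: subvector_def scalar_prod_def)
  also have "\<dots> = sum ?f S + sum ?f T"
    unfolding part(1)[symmetric] using part_simps part(2) by (simp add: sum.union_disjoint)
  also have "\<dots> = (submatrix A Q S *\<^sub>v subvector v S + submatrix A Q T *\<^sub>v subvector v T) $ i"
    using A v i cQ part_simps
    by (simp add: subvector_def submatrix_def scalar_prod_def
        sum_pick[where f = ?f, symmetric])
  finally show "subvector (A *\<^sub>v v) Q $ i
    = (submatrix A Q S *\<^sub>v subvector v S + submatrix A Q T *\<^sub>v subvector v T) $ i" .
qed

lemma mat_at_isospectral_reduction:
  assumes M: "M \<in> carrier_mat n n" and reg: "no_pole_mat M z"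
    and inv: "invertible_mat (submatrix (mat_at M z) T T - z \<cdot>\<^sub>m 1\<^sub>m (card T))"
  shows "mat_at (isospectral_reduction M S T) z =
     submatrix (mat_at M z) S S
     - submatrix (mat_at M z) S T
       * the (mat_inverse (submatrix (mat_at M z) T T - z \<cdot>\<^sub>m 1\<^sub>m (card T)))
       * submatrix (mat_at M z) T S"
proof -
  note sub = mat_has_value_submatrix[OF mat_has_value_mat_at[OF reg]]
  have dims: "submatrix M I J \<in> carrier_mat (card I) (card J)" if "I = S \<or> I = T" "J = S \<or> J = T" for I J
  proof -
    have "{i. i < n \<and> i \<in> I} = I" "{i. i < n \<and> i \<in> J} = J" using that part_simps(1,2) by metis+
    with M show ?thesis by (simp add: submatrix_def)
  qed
  let ?D = "submatrix M T T - ratfun_var \<cdot>\<^sub>m 1\<^sub>m (card T)"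
  have val: "mat_has_value ?D z (submatrix (mat_at M z) T T - z \<cdot>\<^sub>m 1\<^sub>m (card T))"
    using dims[of T T] by (intro mat_has_value_diff sub mat_has_value_var) auto
  have D: "?D \<in> carrier_mat (card T) (card T)" by (intro minus_carrier_mat) simp
  note I = mat_has_value_inverse[OF val D inv]
  have "mat_has_value (isospectral_reduction M S T) z
    (submatrix (mat_at M z) S S
     - submatrix (mat_at M z) S T
       * the (mat_inverse (submatrix (mat_at M z) T T - z \<cdot>\<^sub>m 1\<^sub>m (card T)))
       * submatrix (mat_at M z) T S)"
    unfolding isospectral_reduction_def
    using dims[of S S] dims[of S T] dims[of T S] I(2)
    by (intro mat_has_value_diff mat_has_value_mult sub I(1)) auto
  thus ?thesis by (rule mat_has_value_imp_mat_at)
qed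

lemma preserved_iff_isospectral_reduction:
  assumes M: "M \<in> carrier_mat n n" and reg: "no_pole_mat M z"
    and inv: "invertible_mat (submatrix (mat_at M z) T T - z \<cdot>\<^sub>m 1\<^sub>m (card T))"
    and v: "v \<in> carrier_vec n" and u: "(mat_at M z - z \<cdot>\<^sub>m 1\<^sub>m n) *\<^sub>v v = u"
  shows "preserved M S T z u \<longleftrightarrow>
    (\<exists>c. c \<noteq> 1 \<and>
       (mat_at (isospectral_reduction M S T) z - z \<cdot>\<^sub>m 1\<^sub>m (card S)) *\<^sub>v subvector v S
       = (1 - c) \<cdot>\<^sub>v subvector u S)"
proof -
  define A where "A = mat_at M z"
  have A: "A \<in> carrier_mat n n" using M by (simp add: A_def mat_at_def)
  let ?s = "card S" and ?t = "card T"
  let ?L = "A - z \<cdot>\<^sub>m 1\<^sub>m n"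
  define a where "a = submatrix A S S - z \<cdot>\<^sub>m 1\<^sub>m ?s"
  define b where "b = submatrix A S T"
  define c where "c = submatrix A T S"
  define d where "d = submatrix A T T - z \<cdot>\<^sub>m 1\<^sub>m ?t"
  define p q x y where "p = subvector v S" and "q = subvector v T"
    and "x = subvector u S" and "y = subvector u T"
  have L: "?L \<in> carrier_mat n n" by (intro minus_carrier_mat) simp
  have un: "u \<in> carrier_vec n"
    using mult_mat_vec_carrier[OF L v] u unfolding A_def by simp
  have car: "a \<in> carrier_mat ?s ?s" "b \<in> carrier_mat ?s ?t" "c \<in> carrier_mat ?t ?s"
    "d \<in> carrier_mat ?t ?t" "submatrix A S S \<in> carrier_mat ?s ?s"
    "p \<in> carrier_vec ?s" "q \<in> carrier_vec ?t" "x \<in> carrier_vec ?s" "y \<in> carrier_vec ?t"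
    using A v un minus_carrier_mat[OF smult_carrier_mat[OF one_carrier_mat]]
    by (simp_all add: part_simps a_def b_def c_def d_def p_def q_def x_def y_def submatrix_def subvector_def)
  have lt: "pick Q i < n" "pick Q i \<in> Q" if "i < card Q" "Q = S \<or> Q = T" for Q i
    using pick_in_set_le[OF that(1)] that(2) part by auto
  have inj: "pick Q i = pick Q j \<longleftrightarrow> i = j" if "i < card Q" "j < card Q" for Q i j
    using that by (metis nat_neq_iff pick_mono_le)
  have disj: "pick S i \<noteq> pick T j" "pick T j \<noteq> pick S i" if "i < ?s" "j < ?t" for i j
    using lt(2)[of i S] lt(2)[of j T] that part by auto
  have subL: "submatrix ?L Q Q' = mat (card Q) (card Q')
      (\<lambda>(i, j). A $$ (pick Q i, pick Q' j) - z * (if pick Q i = pick Q' j then 1 else 0))"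
    if "Q = S \<or> Q = T" "Q' = S \<or> Q' = T" for Q Q'
  proof -
    have "{i. i < n \<and> i \<in> Q} = Q" "{i. i < n \<and> i \<in> Q'} = Q'" using that part_simps by auto
    with A lt(1)[OF _ that(1)] lt(1)[OF _ that(2)] show ?thesis
      by (intro eq_matI) (auto simp: submatrix_def)
  qed
  have sub: "submatrix ?L S S = a" "submatrix ?L S T = b" "submatrix ?L T S = c" "submatrix ?L T T = d"
    unfolding a_def b_def c_def d_def using A inj disj
    by (simp_all add: subL, auto intro!: eq_matI simp: submatrix_def part_simps)
  have eqs: "x = a *\<^sub>v p + b *\<^sub>v q" "y = c *\<^sub>v p + d *\<^sub>v q"
    using subvector_mult_mat[OF L v, of S] subvector_mult_mat[OF L v, of T] u
    unfolding sub p_def q_def x_def y_def A_def[symmetric] by auto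
  from invertible_mat_mat_inverse[OF car(4)] inv obtain e where
    e: "mat_inverse d = Some e" "e \<in> carrier_mat ?t ?t" "e * d = 1\<^sub>m ?t"
    unfolding d_def A_def by metis
  have R: "mat_at (isospectral_reduction M S T) z = submatrix A S S - b * e * c"
    using mat_at_isospectral_reduction[OF M reg inv] e(1)
    unfolding A_def[symmetric] d_def[symmetric] b_def[symmetric] c_def[symmetric] by simp
  have ra: "mat_at (isospectral_reduction M S T) z - z \<cdot>\<^sub>m 1\<^sub>m ?s = a - b * e * c"
    unfolding R a_def using car e(2) by (intro eq_matI) (auto simp: algebra_simps)
  have ey: "e *\<^sub>v y = e *\<^sub>v (c *\<^sub>v p) + q"
  proof -
    have "e *\<^sub>v y = e *\<^sub>v (c *\<^sub>v p) + e *\<^sub>v (d *\<^sub>v q)"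
      unfolding eqs using car e(2)
      by (intro mult_add_distrib_mat_vec[of _ ?t ?t]) auto
    also have "e *\<^sub>v (d *\<^sub>v q) = q"
      using car e by (simp add: assoc_mult_mat_vec[symmetric, of e ?t ?t d ?t])
    finally show ?thesis .
  qed
  have bey: "b *\<^sub>v (e *\<^sub>v y) = b *\<^sub>v (e *\<^sub>v (c *\<^sub>v p)) + b *\<^sub>v q"
    unfolding ey using car e(2) by (intro mult_add_distrib_mat_vec[of _ ?s ?t]) auto
  have "(a - b * e * c) *\<^sub>v p = a *\<^sub>v p - (b * e * c) *\<^sub>v p"
    using car e(2) by (intro minus_mult_distrib_mat_vec[of _ ?s ?s]) auto
  also have "(b * e * c) *\<^sub>v p = b *\<^sub>v (e *\<^sub>v (c *\<^sub>v p))"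
    using assoc_mult_mat_vec[OF mult_carrier_mat[OF car(2) e(2)] car(3,6)]
      assoc_mult_mat_vec[OF car(2) e(2) mult_mat_vec_carrier[OF car(3,6)]] by simp
  also have "a *\<^sub>v p - b *\<^sub>v (e *\<^sub>v (c *\<^sub>v p)) = x - b *\<^sub>v (e *\<^sub>v y)"
    unfolding bey eqs(1) using car e(2) by (intro eq_vecI) auto
  finally have main: "(a - b * e * c) *\<^sub>v p = x - b *\<^sub>v (e *\<^sub>v y)" .
  have "b *\<^sub>v (e *\<^sub>v y) = r \<cdot>\<^sub>v x \<longleftrightarrow> x - b *\<^sub>v (e *\<^sub>v y) = (1 - r) \<cdot>\<^sub>v x" for r
  proof -
    have "dim_vec (b *\<^sub>v (e *\<^sub>v y)) = ?s" "dim_vec x = ?s" using car by auto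
    thus ?thesis by (auto simp: vec_eq_iff algebra_simps)
  qed
  thus ?thesis
    unfolding preserved_def ra main[unfolded p_def] p_def[symmetric] A_def[symmetric]
      b_def[symmetric] d_def[symmetric] e(1) option.sel x_def[symmetric] y_def[symmetric] main
    by simp
qed

end

end

theory Submission
  imports Defs
begin

text \<open>
  Write \<open>L = A - z I\<close> with \<open>A = M(z)\<close>, in block form with respect to \<open>S\<close> and \<open>T\<close>. In both cases
  the vector that has to be a multiple of \<open>u\<^sub>S\<close>, namely \<open>A\<^sub>S\<^sub>T (A\<^sub>T\<^sub>T - z I)\<^sup>-\<^sup>1 u\<^sub>T\<close>, vanishes, so
  that \<open>c = 0\<close> is a witness. If \<open>A\<^sub>S\<^sub>T = 0\<close>, this is immediate. If \<open>A\<^sub>T\<^sub>S = 0\<close>, then \<open>L\<close> is block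
  triangular and acts on the \<open>T\<close>-part of any vector by the invertible block \<open>A\<^sub>T\<^sub>T - z I\<close>; hence a
  vector annihilated by a power of \<open>L\<close> has zero \<open>T\<close>-part (\<open>subvector_eq_0_if_pow_mult_eq_0\<close>),
  and \<open>u\<close> is such a vector.
\<close>

lemma subvector_zero_vec: "subvector (0\<^sub>v n :: 'a :: zero vec) T = 0\<^sub>v (card {i. i < n \<and> i \<in> T})"
proof (rule eq_vecI)
  fix i
  assume "i < dim_vec (0\<^sub>v (card {i. i < n \<and> i \<in> T}) :: 'a vec)"
  hence "i < card {i. i < n \<and> i \<in> T}" by simp
  from pick_le[OF this]
  show "subvector (0\<^sub>v n :: 'a vec) T $ i = 0\<^sub>v (card {i. i < n \<and> i \<in> T}) $ i"
    using \<open>i < card _\<close> by (simp add: subvector_def)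
qed (simp add: subvector_def)

lemma invertible_mat_mult_vec_eq_0:
  fixes A :: "'a :: field mat"
  assumes A: "A \<in> carrier_mat m m" and "invertible_mat A"
    and x: "x \<in> carrier_vec m" and Ax: "A *\<^sub>v x = 0\<^sub>v m"
  shows "x = 0\<^sub>v m"
proof -
  from invertible_mat_mat_inverse[OF assms(1,2)] obtain B where
    B: "B \<in> carrier_mat m m" "B * A = 1\<^sub>m m" by metis
  have "x = (B * A) *\<^sub>v x" using B x by simp
  also have "\<dots> = B *\<^sub>v (A *\<^sub>v x)" using A B x by (intro assoc_mult_mat_vec)
  also have "\<dots> = 0\<^sub>v m" unfolding Ax using B by (intro eq_vecI) auto
  finally show ?thesis .
qed

text \<open>
  The diagonal entries of the whole matrix lie in the diagonal blocks, so subtracting a scalar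
  matrix commutes with taking a diagonal block and leaves the other blocks unchanged.
\<close>

lemma submatrix_minus_scalar_diag:
  fixes A :: "'a :: comm_ring_1 mat"
  assumes A: "A \<in> carrier_mat n n" and T: "T \<subseteq> {0..<n}"
  shows "submatrix (A - z \<cdot>\<^sub>m 1\<^sub>m n) T T = submatrix A T T - z \<cdot>\<^sub>m 1\<^sub>m (card T)"
proof -
  have cT: "{i. i < n \<and> i \<in> T} = T" using T by auto
  have lt: "pick T i < n" if "i < card T" for i
    using pick_in_set_le[OF that] T by auto
  have inj: "pick T i = pick T j \<longleftrightarrow> i = j" if "i < card T" "j < card T" for i j
    using that by (metis nat_neq_iff pick_mono_le)
  show ?thesis using A cT lt inj by (intro eq_matI) (auto simp: submatrix_def)
qed

lemma submatrix_minus_scalar_offdiag: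
  fixes A :: "'a :: comm_ring_1 mat"
  assumes A: "A \<in> carrier_mat n n" and S: "S \<subseteq> {0..<n}" and T: "T \<subseteq> {0..<n}"
    and disj: "S \<inter> T = {}"
  shows "submatrix (A - z \<cdot>\<^sub>m 1\<^sub>m n) T S = submatrix A T S"
proof -
  have c: "{i. i < n \<and> i \<in> T} = T" "{i. i < n \<and> i \<in> S} = S" using S T by auto
  have lt: "pick T i \<in> T" "pick T i < n" if "i < card T" for i
    using pick_in_set_le[OF that] T by auto
  have lt': "pick S i \<in> S" "pick S i < n" if "i < card S" for i
    using pick_in_set_le[OF that] S by auto
  have "pick T i \<noteq> pick S j" if "i < card T" "j < card S" for i j
    using lt(1)[OF that(1)] lt'(1)[OF that(2)] disj by auto
  with A c lt lt' show ?thesis by (intro eq_matI) (auto simp: submatrix_def)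
qed

text \<open>
  Since \<open>L\<^sub>T\<^sub>S = 0\<close>, the \<open>T\<close>-part of \<open>L w\<close> is \<open>L\<^sub>T\<^sub>T w\<^sub>T\<close>, and \<open>L\<^sub>T\<^sub>T\<close> is injective; each of the
  \<open>k\<close> factors of \<open>L\<close> can therefore be cancelled on the \<open>T\<close>-part.
\<close>

lemma subvector_eq_0_if_pow_mult_eq_0:
  fixes L :: "'a :: field mat"
  assumes part: "S \<union> T = {0..<n}" "S \<inter> T = {}"
    and L: "L \<in> carrier_mat n n"
    and LTS: "submatrix L T S = 0\<^sub>m (card T) (card S)"
    and inv: "invertible_mat (submatrix L T T)"
    and w: "w \<in> carrier_vec n" and pow: "L ^\<^sub>m k *\<^sub>v w = 0\<^sub>v n"
  shows "subvector w T = 0\<^sub>v (card T)"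
  using w pow
proof (induction k arbitrary: w)
  case 0
  have "w = 0\<^sub>v n" using 0 L by simp
  thus ?case using subvector_zero_vec[of n T] part_simps[OF part] by simp
next
  case (Suc k)
  note cards = part_simps[OF part]
  have carr: "subvector w S \<in> carrier_vec (card S)" "subvector w T \<in> carrier_vec (card T)"
    "submatrix L T T \<in> carrier_mat (card T) (card T)"
    using Suc.prems(1) L cards by (simp_all add: subvector_def submatrix_def)
  have Lw: "L *\<^sub>v w \<in> carrier_vec n" using L Suc.prems(1) by simp
  have "L ^\<^sub>m k *\<^sub>v (L *\<^sub>v w) = 0\<^sub>v n"
    using Suc.prems(2) assoc_mult_mat_vec[OF pow_carrier_mat[OF L] L Suc.prems(1)] by simp
  from Suc.IH[OF Lw this] have "0\<^sub>v (card T) = subvector (L *\<^sub>v w) T" by simp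
  also have "\<dots> = submatrix L T S *\<^sub>v subvector w S + submatrix L T T *\<^sub>v subvector w T"
    by (intro subvector_mult_mat[OF part L Suc.prems(1)]) simp
  also have "submatrix L T S *\<^sub>v subvector w S = 0\<^sub>v (card T)"
    unfolding LTS using carr by (intro eq_vecI) auto
  finally have "submatrix L T T *\<^sub>v subvector w T = 0\<^sub>v (card T)"
    using carr by simp
  from invertible_mat_mult_vec_eq_0[OF carr(3) inv carr(2) this] show ?case .
qed

lemma gen_eigenvector_pow_mult_eq_0:
  assumes A: "A \<in> carrier_mat n n" and "gen_eigenvector A z k u"
  shows "u \<in> carrier_vec n" "(A - z \<cdot>\<^sub>m 1\<^sub>m n) ^\<^sub>m k *\<^sub>v u = 0\<^sub>v n"
proof -
  have "u \<in> carrier_vec n \<and> (A - z \<cdot>\<^sub>m 1\<^sub>m n) ^\<^sub>m k *\<^sub>v u = 0\<^sub>v n"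
  proof (cases "k = 1")
    case True
    with assms have u: "u \<in> carrier_vec n" "A *\<^sub>v u = z \<cdot>\<^sub>v u"
      by (auto simp: gen_eigenvector_def eigenvector_def)
    have "(z \<cdot>\<^sub>m 1\<^sub>m n) *\<^sub>v u = z \<cdot>\<^sub>v u"
    proof (rule eq_vecI)
      fix i
      assume "i < dim_vec (z \<cdot>\<^sub>v u)"
      hence i: "i < n" using u by simp
      hence "row (z \<cdot>\<^sub>m 1\<^sub>m n) i = z \<cdot>\<^sub>v unit_vec n i" by (intro eq_vecI) auto
      thus "((z \<cdot>\<^sub>m 1\<^sub>m n) *\<^sub>v u) $ i = (z \<cdot>\<^sub>v u) $ i" using u i by simp
    qed (use u in simp)
    moreover have "(A - z \<cdot>\<^sub>m 1\<^sub>m n) *\<^sub>v u = A *\<^sub>v u - (z \<cdot>\<^sub>m 1\<^sub>m n) *\<^sub>v u"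
      using A u by (intro minus_mult_distrib_mat_vec) auto
    ultimately have "(A - z \<cdot>\<^sub>m 1\<^sub>m n) *\<^sub>v u = 0\<^sub>v n" using u by simp
    with True A u show ?thesis by simp
  next
    case False
    with assms show ?thesis by (auto simp: gen_eigenvector_def)
  qed
  thus "u \<in> carrier_vec n" "(A - z \<cdot>\<^sub>m 1\<^sub>m n) ^\<^sub>m k *\<^sub>v u = 0\<^sub>v n" by auto
qed

theorem theorem5:
  fixes M :: "ratfun mat" and n :: nat and S T :: "nat set" and z :: complex
  assumes "M \<in> carrier_mat n n"
    and "S \<union> T = {0..<n}" and "S \<inter> T = {}" and "S \<noteq> {}"
    and "no_pole_mat M z"
    and "invertible_mat (submatrix (mat_at M z) T T - z \<cdot>\<^sub>m 1\<^sub>m (card T))"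
    and "submatrix (mat_at M z) S T = 0\<^sub>m (card S) (card T)
       \<or> submatrix (mat_at M z) T S = 0\<^sub>m (card T) (card S)"
  shows "gen_eigenvectors_preserved M S T z"
  unfolding gen_eigenvectors_preserved_def
proof (intro allI impI)
  fix k u v
  define A where "A = mat_at M z"
  assume "gen_eigenvector (mat_at M z) z k u"
  hence gen: "gen_eigenvector A z k u" by (simp add: A_def)
  note part = assms(2,3)
  note cards = part_simps[OF part]
  have A: "A \<in> carrier_mat n n" using assms(1) by (simp add: A_def mat_at_def)
  note u = gen_eigenvector_pow_mult_eq_0[OF A gen]
  define d where "d = submatrix A T T - z \<cdot>\<^sub>m 1\<^sub>m (card T)"
  have d: "d \<in> carrier_mat (card T) (card T)"
    unfolding d_def by (intro minus_carrier_mat) simp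
  have inv: "invertible_mat d" using assms(6) by (simp add: d_def A_def)
  from invertible_mat_mat_inverse[OF d inv] obtain e where
    e: "mat_inverse d = Some e" "e \<in> carrier_mat (card T) (card T)" by metis
  have carr: "submatrix A S T \<in> carrier_mat (card S) (card T)"
    "subvector u S \<in> carrier_vec (card S)" "subvector u T \<in> carrier_vec (card T)"
    using A u cards by (simp_all add: submatrix_def subvector_def)
  have "submatrix A S T *\<^sub>v (e *\<^sub>v subvector u T) = 0\<^sub>v (card S)"
    using assms(7)
  proof
    assume "submatrix (mat_at M z) S T = 0\<^sub>m (card S) (card T)"
    thus ?thesis
      unfolding A_def[symmetric] using e carr by (intro eq_vecI) auto
  next
    assume TS: "submatrix (mat_at M z) T S = 0\<^sub>m (card T) (card S)"
    let ?L = "A - z \<cdot>\<^sub>m 1\<^sub>m n"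
    have sub: "S \<subseteq> {0..<n}" "T \<subseteq> {0..<n}" using part by auto
    have "?L \<in> carrier_mat n n" by (intro minus_carrier_mat) simp
    moreover have "submatrix ?L T S = 0\<^sub>m (card T) (card S)"
      using submatrix_minus_scalar_offdiag[OF A sub part(2)] TS by (simp add: A_def)
    moreover have "invertible_mat (submatrix ?L T T)"
      using submatrix_minus_scalar_diag[OF A sub(2)] inv by (simp add: d_def)
    ultimately have "subvector u T = 0\<^sub>v (card T)"
      using u by (intro subvector_eq_0_if_pow_mult_eq_0[OF part])
    moreover have "e *\<^sub>v 0\<^sub>v (card T) = 0\<^sub>v (card T)"
      using e(2) by (intro eq_vecI) auto
    moreover have "submatrix A S T *\<^sub>v 0\<^sub>v (card T) = 0\<^sub>v (card S)"
      using carr(1) by (intro eq_vecI) auto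
    ultimately show ?thesis by simp
  qed
  also have "\<dots> = 0 \<cdot>\<^sub>v subvector u S" using carr by (intro eq_vecI) auto
  finally show "preserved M S T z u"
    unfolding preserved_def A_def[symmetric] d_def[symmetric] e(1) option.sel
    by (intro exI[of _ 0]) simp
qed

end
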